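(* Let $\check z_{-L}<0<\check z_R$ be such that $\max\{1-\Phi(\check z_R),\,\Phi(\check z_{-L})\}\le\tau$, where $0<\tau\ll\min\{|\check z_{-L}|,\,\check z_R\}$. Then $O\Big(\sqrt{\tfrac1\tau\log\big(\tfrac1\tau\big)}\Big)$ breakpoints are sufficient to ensure $$0\le\bar\Phi(z;\check{\boldsymbol z})-\Phi(z)\le\tau\qquad\text{for all } z\in\mathbb R .$$ Here the number of breakpoints is $|\mathcal A|$, where $\mathcal A=\mathcal A^L\cup\mathcal A^R$ is the set of breakpoints (forming the array $\check{\boldsymbol z}$) constructed from the inputs $\check z_{-L},\check z_R,\tau$ by the tangent algorithm and the secant algorithm described in the context.
   Context: $\Phi$ and $\phi$ denote the cumulative distribution function and the density of the standard normal distribution. $[m]=\{1,\dots,m\}$ and $[m]_0=\{0,1,\dots,m\}$. A valid array of breakpoints is a vector $\check{\boldsymbol z}=(\check z_{-L},\dots,\check z_{-1},\check z_0,\check z_1,\dots,\check z_R)\in\mathbb R^{L+R+1}$, with integers $L,R>0$, such that $-\infty<\check z_{-L}<\dots<\check z_{-1}<\check z_0=0<\check z_1<\dots<\check z_R<\infty$. The values of the two end points $\check z_{-L},\check z_R$ are prescribed; the remaining breakpoints, and hence the integers $L$ and $R$, are determined by the algorithms below. The piecewise linear outer approximation of $\Phi$ associated with $\check{\boldsymbol z}$ is $$\bar\Phi(z;\check{\boldsymbol z})=\begin{cases}\min\{1,\ \min_{i\in[R]_0}(g_i z+g_i^0)\}, & z\ge 0,\\ \max\{\Phi(\check z_{-L}),\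 \max_{i\in[L]}(h_i z+h_i^0)\}, & z<0,\end{cases}$$ where $g_i=\phi(\check z_i)$ and $g_i^0=\Phi(\check z_i)-\phi(\check z_i)\check z_i$ for $i\in[R]_0$ (tangents), and $h_i=\frac{\Phi(\check z_{-i+1})-\Phi(\check z_{-i})}{\check z_{-i+1}-\check z_{-i}}$ and $h_i^0=\Phi(\check z_{-i})-h_i\check z_{-i}$ for $i\in[L]$ (secants). For $u\neq 0$ write $s(u)=\sqrt{\frac{2\tau}{\phi(u)|u|}}$; note that $|\Phi''(u)|=\phi(u)|u|$. Tangent algorithm (input $\check z_R,\tau$; output $\mathcal A^R$). Part 1, for the interval $[0,1]$: start at the point $u=1$ and put it in $\mathcal A^R$; as long as the next point $u-s(u)$ is positive, add it to $\mathcal A^R$ and replace $u$ by it; when the next point is no longer positive, add $0$ to $\mathcal A^R$. Part 2, for the interval $[1,\check z_R]$: start again at $u=1$; as long as the next point $u+s(u)$ is less than $\check z_R$, add it to $\mathcal A^R$ and replace $u$ by it; then add $\check z_R$ to $\mathcal A^R$. Secant algorithm (input $\check z_{-L},\tau$; output $\mathcal A^L$). Part 1, for the interval $[-1,0]$: start at the point $u=-1$ and put it in $\mathcal A^L$; as long as the next point $u+2s(u)$ is negative, add it to $\mathcal A^L$ and replace $u$ by it. Part 2, for the interval $[\check z_{-L},-1]$: start again at $u=-1$; as long as the next point $u-2s(u)$ is greater than $\check z_{-L}$, add it to $\mathcal A^L$ and replace $u$ by it; then add $\check z_{-L}$ to $\mathcal A^L$. The array $\check{\boldsymbol z}$ consists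 of the elements of $\mathcal A=\mathcal A^L\cup\mathcal A^R$ in increasing order.
   Formalization: The bound on |A| is proved when log max{|ž_{-L}|, ž_R} ≤ K·sqrt((1/τ)log(1/τ)), with the O-constant depending only on K; without a bound on the end points it fails, since for fixed τ, |A| grows unboundedly as ž_R→∞. "τ ≪" is read as τ below a threshold. *)

theory Defs
  imports "HOL-Probability.Probability"
begin

abbreviation normal_pdf :: "real \<Rightarrow> real" where
  "normal_pdf \<equiv> std_normal_density"

abbreviation normal_cdf :: "real \<Rightarrow> real" where
  "normal_cdf \<equiv> cdf std_normal_distribution"


text \<open>An array of breakpoints is a function on the integers of which only the values at the
  indices \<open>-L, \<dots>, R\<close> matter.\<close>

definition valid_breakpoints :: "real \<Rightarrow> real \<Rightarrow> nat \<Rightarrow> nat \<Rightarrow> (int \<Rightarrow> real) \<Rightarrow> bool" where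
  "valid_breakpoints zL zR L R z \<longleftrightarrow>
     0 < L \<and> 0 < R \<and> strict_mono_on {- int L..int R} z \<and>
     z (- int L) = zL \<and> z 0 = 0 \<and> z (int R) = zR"

definition tangent_slope :: "(int \<Rightarrow> real) \<Rightarrow> nat \<Rightarrow> real" where
  "tangent_slope z i = normal_pdf (z (int i))"

definition tangent_intercept :: "(int \<Rightarrow> real) \<Rightarrow> nat \<Rightarrow> real" where
  "tangent_intercept z i =
     normal_cdf (z (int i)) - normal_pdf (z (int i)) * z (int i)"

definition secant_slope :: "(int \<Rightarrow> real) \<Rightarrow> nat \<Rightarrow> real" where
  "secant_slope z i =
     (normal_cdf (z (- int i + 1)) - normal_cdf (z (- int i))) / (z (- int i + 1) - z (- int i))"

definition secant_intercept :: "(int \<Rightarrow> real) \<Rightarrow> nat \<Rightarrow> real" where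
  "secant_intercept z i = normal_cdf (z (- int i)) - secant_slope z i * z (- int i)"

definition outer_approx :: "nat \<Rightarrow> nat \<Rightarrow> (int \<Rightarrow> real) \<Rightarrow> real \<Rightarrow> real" where
  "outer_approx L R z x =
     (if x \<ge> 0
      then min 1 (MIN i\<in>{0..R}. tangent_slope z i * x + tangent_intercept z i)
      else max (normal_cdf (z (- int L)))
             (MAX i\<in>{1..L}. secant_slope z i * x + secant_intercept z i))"


definition step_size :: "real \<Rightarrow> real \<Rightarrow> real" where
  "step_size \<tau> u = sqrt (2 * \<tau> / (normal_pdf u * \<bar>u\<bar>))"

text \<open>Each loop of the two algorithms is rendered as the inductive set of the points it visits.
  Termination is not built in: a loop that does not stop yields an infinite set.\<close>

inductive_set tangent_loop1 :: "real \<Rightarrow> real set" for \<tau> :: real where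
  start: "1 \<in> tangent_loop1 \<tau>"
| step: "u \<in> tangent_loop1 \<tau> \<Longrightarrow> u - step_size \<tau> u > 0 \<Longrightarrow> u - step_size \<tau> u \<in> tangent_loop1 \<tau>"

inductive_set tangent_loop2 :: "real \<Rightarrow> real \<Rightarrow> real set" for zR \<tau> :: real where
  start: "1 \<in> tangent_loop2 zR \<tau>"
| step: "u \<in> tangent_loop2 zR \<tau> \<Longrightarrow> u + step_size \<tau> u < zR \<Longrightarrow>
         u + step_size \<tau> u \<in> tangent_loop2 zR \<tau>"

definition tangent_points :: "real \<Rightarrow> real \<Rightarrow> real set" where
  "tangent_points zR \<tau> = tangent_loop1 \<tau> \<union> {0} \<union> tangent_loop2 zR \<tau> \<union> {zR}"

inductive_set secant_loop1 :: "real \<Rightarrow> real set" for \<tau> :: real where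
  start: "-1 \<in> secant_loop1 \<tau>"
| step: "u \<in> secant_loop1 \<tau> \<Longrightarrow> u + 2 * step_size \<tau> u < 0 \<Longrightarrow>
         u + 2 * step_size \<tau> u \<in> secant_loop1 \<tau>"

inductive_set secant_loop2 :: "real \<Rightarrow> real \<Rightarrow> real set" for zL \<tau> :: real where
  start: "-1 \<in> secant_loop2 zL \<tau>"
| step: "u \<in> secant_loop2 zL \<tau> \<Longrightarrow> u - 2 * step_size \<tau> u > zL \<Longrightarrow>
         u - 2 * step_size \<tau> u \<in> secant_loop2 zL \<tau>"

definition secant_points :: "real \<Rightarrow> real \<Rightarrow> real set" where
  "secant_points zL \<tau> = secant_loop1 \<tau> \<union> secant_loop2 zL \<tau> \<union> {zL}"

definition breakpoints :: "real \<Rightarrow> real \<Rightarrow> real \<Rightarrow> real set" where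
  "breakpoints zL zR \<tau> = secant_points zL \<tau> \<union> tangent_points zR \<tau>"


definition num_left :: "real set \<Rightarrow> nat" where
  "num_left A = card {a \<in> A. a < 0}"

definition num_right :: "real set \<Rightarrow> nat" where
  "num_right A = card {a \<in> A. a > 0}"

text \<open>The elements of a finite set in increasing order, with the index shifted so that
  the element \<open>0\<close> gets index \<open>0\<close>.\<close>

definition breakpoint_array :: "real set \<Rightarrow> int \<Rightarrow> real" where
  "breakpoint_array A i = sorted_list_of_set A ! nat (i + int (num_left A))"

end

theory Submission
  imports Defs
begin

text \<open>The curvature \<open>\<bar>\<Phi>''(u)\<bar> = \<phi>(u) \<bar>u\<bar>\<close> increases on \<open>[0, 1]\<close> and decreases on \<open>[1, \<infinity>)\<close>.
  Hence on the interval from a visited point \<open>u\<close> to its successor it is largest at \<open>u\<close>, and the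
  step \<open>s(u)\<close> makes the tangent error \<open>\<phi>(u) \<bar>u\<bar> s(u)\<^sup>2 / 2\<close> and the secant error
  \<open>\<phi>(u) \<bar>u\<bar> (2 s(u))\<^sup>2 / 8\<close> both equal to \<open>\<tau>\<close>. For the count, \<open>s(u) \<ge> s(1)\<close>, which is of
  order \<open>sqrt \<tau>\<close>, so at most \<open>T / s(1) + 1\<close> steps are made up to \<open>T = 4 sqrt (ln (1 / \<tau>))\<close>. Beyond
  \<open>T\<close> we have \<open>s(u) \<ge> u\<close>, so that the points at least double and only logarithmically many
  steps remain.\<close>

subsection \<open>Derivatives of the normal distribution function\<close>

lemma has_real_derivative_normal_pdf:
  "(normal_pdf has_real_derivative - (x * normal_pdf x)) (at x)"
  unfolding std_normal_density_def
  by (auto intro!: derivative_eq_intros simp: field_simps)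

interpretation std_normal: real_distribution std_normal_distribution
  by (rule real_dist_normal_dist)

text \<open>The distribution function is defined through a measure, so a primitive \<open>G\<close>
  of the continuous density on a window around \<open>x\<close> is compared with it: by the
  fundamental theorem of calculus the mass of \<open>{a<..t}\<close> is \<open>G t - G a\<close>.
  Near \<open>x\<close> the two functions thus differ by a constant.\<close>

lemma has_real_derivative_normal_cdf:
  "(normal_cdf has_real_derivative normal_pdf x) (at x)"
proof -
  define a b where "a = x - 1" and "b = x + 1"
  have cont: "continuous_on A normal_pdf" for A
    by (intro continuous_at_imp_continuous_on ballI DERIV_isCont[OF has_real_derivative_normal_pdf])
  obtain G where G: "\<And>t. t \<in> {a..b} \<Longrightarrow> (G has_vector_derivative normal_pdf t) (at t within {a..b})"
    using antiderivative_continuous[OF cont] by blast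
  have cdf_eq: "normal_cdf t = normal_cdf a + (G t - G a)" if t: "a \<le> t" "t \<le> b" for t
  proof (cases "a = t")
    case False
    then have "a < t" using t by simp
    have G': "(G has_vector_derivative normal_pdf s) (at s within {a..t})" if "a \<le> s" "s \<le> t" for s
      using that t by (intro has_vector_derivative_within_subset[OF G]) auto
    have hb: "has_bochner_integral lborel (\<lambda>s. normal_pdf s * indicator {a..t} s) (G t - G a)"
      using \<open>a < t\<close> has_bochner_integral_FTC_Icc[OF _ G' cont]
      by (simp add: mult.commute)
    have "emeasure std_normal_distribution {a<..t} =
        (\<integral>\<^sup>+s. ennreal (normal_pdf s) * indicator {a<..t} s \<partial>lborel)"
      by (subst emeasure_density) auto
    \<comment> \<open>The half-open interval, natural for \<open>cdf\<close>, and the closed one,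
      natural for the primitive, differ only in the null set \<open>{a}\<close>.\<close>
    also have "\<dots> = (\<integral>\<^sup>+s. ennreal (normal_pdf s * indicator {a..t} s) \<partial>lborel)"
      using AE_lborel_singleton[of a]
      by (intro nn_integral_cong_AE, eventually_elim) (auto simp: indicator_def)
    also have "\<dots> = ennreal (G t - G a)"
      by (subst nn_integral_eq_integral[OF integrable.intros[OF hb]])
         (use has_bochner_integral_integral_eq[OF hb] in auto)
    moreover have "0 \<le> G t - G a"
      unfolding has_bochner_integral_integral_eq[OF hb, symmetric]
      by (intro Bochner_Integration.integral_nonneg) (simp add: indicator_def)
    ultimately have "measure std_normal_distribution {a<..t} = G t - G a"
      by (simp add: measure_def)
    then show ?thesis
      using std_normal.cdf_diff_eq[OF \<open>a < t\<close>] by simp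
  qed simp
  have "(G has_real_derivative normal_pdf x) (at x within {a<..<b})"
    using G[of x] unfolding has_real_derivative_iff_has_vector_derivative a_def b_def
    by (intro has_vector_derivative_within_subset[OF G[unfolded a_def b_def]]) auto
  then have "(G has_real_derivative normal_pdf x) (at x)"
    by (subst (asm) at_within_open) (auto simp: a_def b_def)
  then have "((\<lambda>t. normal_cdf a + (G t - G a)) has_real_derivative normal_pdf x) (at x)"
    by (auto intro!: derivative_eq_intros)
  then show ?thesis
    by (rule has_field_derivative_transform_within[where d = 1])
       (auto simp: dist_real_def a_def b_def intro!: cdf_eq[symmetric, unfolded a_def b_def])
qed

section \<open>Monotonicity and range of \<Phi>\<close>

lemma normal_cdf_strict_mono: "x < y \<Longrightarrow> normal_cdf x < normal_cdf y"
  by (rule DERIV_pos_imp_increasing)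
     (auto intro!: exI[of _ "normal_pdf _"] has_real_derivative_normal_cdf normal_density_pos)

lemma normal_cdf_mono: "x \<le> y \<Longrightarrow> normal_cdf x \<le> normal_cdf y"
  by (rule std_normal.cdf_nondecreasing)

lemma normal_cdf_pos: "0 < normal_cdf x"
  using normal_cdf_strict_mono[of "x - 1" x] std_normal.cdf_nonneg[of "x - 1"] by linarith

lemma normal_cdf_less_1: "normal_cdf x < 1"
  using normal_cdf_strict_mono[of x "x + 1"] std_normal.cdf_bounded_prob[of "x + 1"] by linarith

section \<open>Monotonicity of the curvature\<close>

lemma normal_pdf_abs_mono_le_1:
  assumes "\<bar>u\<bar> \<le> \<bar>v\<bar>" "\<bar>v\<bar> \<le> 1"
  shows "normal_pdf u * \<bar>u\<bar> \<le> normal_pdf v * \<bar>v\<bar>"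
proof -
  have "normal_pdf \<bar>u\<bar> * \<bar>u\<bar> \<le> normal_pdf \<bar>v\<bar> * \<bar>v\<bar>"
  proof (rule DERIV_nonneg_imp_nondecreasing[where f = "\<lambda>x. normal_pdf x * x"])
    fix x assume x: "\<bar>u\<bar> \<le> x" "x \<le> \<bar>v\<bar>"
    \<comment> \<open>The factor \<open>1 - x\<^sup>2\<close> decides the sign of the derivative:
      the curvature grows up to 1 and falls afterwards. Evenness of the density carries this over to
      negative arguments.\<close>
    have "((\<lambda>x. normal_pdf x * x) has_real_derivative normal_pdf x * (1 - x\<^sup>2)) (at x)"
      by (auto intro!: derivative_eq_intros has_real_derivative_normal_pdf
               simp: algebra_simps power2_eq_square)
    moreover have "0 \<le> normal_pdf x * (1 - x\<^sup>2)"
      using x assms by (intro mult_nonneg_nonneg) (auto simp: abs_square_le_1)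
    ultimately show "\<exists>y. ((\<lambda>x. normal_pdf x * x) has_real_derivative y) (at x) \<and> 0 \<le> y" by blast
  qed (use assms in auto)
  then show ?thesis by (simp add: std_normal_density_def)
qed

lemma normal_pdf_abs_antimono_ge_1:
  assumes "1 \<le> \<bar>u\<bar>" "\<bar>u\<bar> \<le> \<bar>v\<bar>"
  shows "normal_pdf v * \<bar>v\<bar> \<le> normal_pdf u * \<bar>u\<bar>"
proof -
  have "normal_pdf \<bar>v\<bar> * \<bar>v\<bar> \<le> normal_pdf \<bar>u\<bar> * \<bar>u\<bar>"
  proof (rule DERIV_nonpos_imp_nonincreasing[where f = "\<lambda>x. normal_pdf x * x"])
    fix x assume x: "\<bar>u\<bar> \<le> x" "x \<le> \<bar>v\<bar>"
    have "((\<lambda>x. normal_pdf x * x) has_real_derivative normal_pdf x * (1 - x\<^sup>2)) (at x)"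
      by (auto intro!: derivative_eq_intros has_real_derivative_normal_pdf
               simp: algebra_simps power2_eq_square)
    moreover have "normal_pdf x * (1 - x\<^sup>2) \<le> 0"
      using x assms by (intro mult_nonneg_nonpos) auto
    ultimately show "\<exists>y. ((\<lambda>x. normal_pdf x * x) has_real_derivative y) (at x) \<and> y \<le> 0" by blast
  qed (use assms in auto)
  then show ?thesis by (simp add: std_normal_density_def)
qed

lemma normal_pdf_abs_le: "normal_pdf u * \<bar>u\<bar> \<le> normal_pdf 1"
  using normal_pdf_abs_mono_le_1[of u 1] normal_pdf_abs_antimono_ge_1[of 1 u]
  by (cases "\<bar>u\<bar> \<le> 1") auto

subsection \<open>Errors of tangents and secants\<close>

text \<open>A convex function lies above its tangents. This is applied to \<open>- f\<close> for the
  first bound and to \<open>f x + M * x\<^sup>2 / 2\<close> for the second. The segment is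
  undirected, so \<open>y\<close> may lie on either side of \<open>u\<close>.\<close>

lemma tangent_error_bounds:
  assumes f: "\<And>x. x \<in> closed_segment u y \<Longrightarrow> (f has_real_derivative f' x) (at x)"
    and f': "\<And>x. x \<in> closed_segment u y \<Longrightarrow> (f' has_real_derivative f'' x) (at x)"
    and bounds: "\<And>x. x \<in> closed_segment u y \<Longrightarrow> - M \<le> f'' x \<and> f'' x \<le> 0"
  shows "f y \<le> f u + f' u * (y - u)"
    and "f u + f' u * (y - u) \<le> f y + M * (y - u)\<^sup>2 / 2"
proof -
  have "- f' u * (y - u) \<le> - f y - - f u"
    by (rule f''_imp_f'[where C = "closed_segment u y" and f'' = "\<lambda>x. - f'' x"])
       (use assms in \<open>auto intro!: derivative_eq_intros\<close>)
  then show "f y \<le> f u + f' u * (y - u)" by simp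
  have "(f' u + M * u) * (y - u) \<le> (f y + M * y\<^sup>2 / 2) - (f u + M * u\<^sup>2 / 2)"
  proof (rule f''_imp_f'[where C = "closed_segment u y" and f'' = "\<lambda>x. f'' x + M"
        and f' = "\<lambda>x. f' x + M * x" and f = "\<lambda>x. f x + M * x\<^sup>2 / 2"])
    show "0 \<le> f'' x + M" if "x \<in> closed_segment u y" for x
      using bounds[OF that] by simp
  qed (use f f' in \<open>auto intro!: derivative_eq_intros\<close>)
  then show "f u + f' u * (y - u) \<le> f y + M * (y - u)\<^sup>2 / 2"
    by (simp add: power2_eq_square field_simps)
qed

text \<open>Both \<open>f\<close> and \<open>M * x\<^sup>2 / 2 - f x\<close> are convex and hence
  lie below their chords. The chord inequality of the second function bounds the error of the secant
  of \<open>f\<close> by \<open>M * ((x - a) * (b - x)) / 2\<close>.\<close>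

lemma secant_error_bounds:
  fixes f :: "real \<Rightarrow> real"
  assumes "a < b" "x \<in> {a..b}"
    and f: "\<And>x. x \<in> {a..b} \<Longrightarrow> (f has_real_derivative f' x) (at x)"
    and f': "\<And>x. x \<in> {a..b} \<Longrightarrow> (f' has_real_derivative f'' x) (at x)"
    and bounds: "\<And>x. x \<in> {a..b} \<Longrightarrow> 0 \<le> f'' x \<and> f'' x \<le> M"
  shows "f x \<le> (f b - f a) / (b - a) * (x - a) + f a"
    and "(f b - f a) / (b - a) * (x - a) + f a \<le> f x + M * (b - a)\<^sup>2 / 8"
proof -
  show "f x \<le> (f b - f a) / (b - a) * (x - a) + f a"
    by (rule convex_onD_Icc'[OF f''_ge0_imp_convex]) (use assms in auto)
  let ?h = "\<lambda>x. M * x\<^sup>2 / 2 - f x"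
  have "convex_on {a..b} ?h"
  proof (rule f''_ge0_imp_convex[where f' = "\<lambda>x. M * x - f' x" and f'' = "\<lambda>x. M - f'' x"])
    show "0 \<le> M - f'' x" if "x \<in> {a..b}" for x
      using bounds[OF that] by simp
  qed (use f f' in \<open>auto intro!: derivative_eq_intros\<close>)
  from convex_onD_Icc'[OF this \<open>x \<in> {a..b}\<close>]
  have "?h x \<le> (?h b - ?h a) / (b - a) * (x - a) + ?h a" .
  also have "(?h b - ?h a) / (b - a) = M * (a + b) / 2 - (f b - f a) / (b - a)"
    using \<open>a < b\<close> by (simp add: field_simps power2_eq_square)
  finally have *: "(f b - f a) / (b - a) * (x - a) + f a \<le> f x + M * ((x - a) * (b - x)) / 2"
    by (simp add: algebra_simps power2_eq_square add_divide_distrib diff_divide_distrib)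
  have "0 \<le> M" using bounds[of a] \<open>a < b\<close> by auto
  \<comment> \<open>The product is largest at the midpoint, which turns the constant 1/2 into
    1/8.\<close>
  moreover have "(x - a) * (b - x) \<le> (b - a)\<^sup>2 / 4"
    using zero_le_power2[of "2 * x - (a + b)"] by (simp add: algebra_simps power2_eq_square)
  ultimately have "M * ((x - a) * (b - x)) \<le> M * ((b - a)\<^sup>2 / 4)"
    by (rule mult_left_mono[rotated])
  with * show "(f b - f a) / (b - a) * (x - a) + f a \<le> f x + M * (b - a)\<^sup>2 / 8"
    by simp
qed

text \<open>Chord slopes of a convex function increase, so the extended chord runs below the graph
  outside \<open>{a..b}\<close>. In the maximum over all secants, those of intervals not containing
  \<open>x\<close> therefore cannot exceed \<Phi> at \<open>x\<close>.\<close>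

lemma convex_on_secant_le:
  fixes f :: "real \<Rightarrow> real"
  assumes f: "convex_on I f" and I: "a \<in> I" "b \<in> I" "x \<in> I" and "a < b" "x \<le> a \<or> b \<le> x"
  shows "(f b - f a) / (b - a) * (x - a) + f a \<le> f x"
proof -
  consider "x = a" | "x = b" | "x < a" | "b < x" using assms by fastforce
  then show ?thesis
  proof cases
    case 3
    from convex_on_slope_le(2)[OF convex_on_subset[OF f], of I x b a]
      convex_on_slope_le[OF f \<open>x \<in> I\<close> \<open>b \<in> I\<close> 3 \<open>a < b\<close>]
    have "(f x - f a) / (x - a) \<le> (f a - f b) / (a - b)" by linarith
    also have "\<dots> = (f b - f a) / (b - a)" by (metis minus_diff_eq minus_divide_divide)
    finally show ?thesis using 3 by (simp add: neg_divide_le_eq)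
  next
    case 4
    from convex_on_slope_le(1)[OF f \<open>a \<in> I\<close> \<open>x \<in> I\<close> \<open>a < b\<close> 4]
    have "(f b - f a) / (b - a) \<le> (f x - f a) / (x - a)"
      by (metis minus_diff_eq minus_divide_divide)
    then show ?thesis using 4 \<open>a < b\<close> by (simp add: pos_le_divide_eq)
  qed (use \<open>a < b\<close> in auto)
qed

subsection \<open>The step size\<close>

lemma normal_pdf_abs_pos: "u \<noteq> 0 \<Longrightarrow> 0 < normal_pdf u * \<bar>u\<bar>"
  by (simp add: normal_density_pos)

lemma step_size_minus [simp]: "step_size \<tau> (- u) = step_size \<tau> u"
  by (simp add: step_size_def std_normal_density_def)

lemma step_size_pos: "0 < \<tau> \<Longrightarrow> u \<noteq> 0 \<Longrightarrow> 0 < step_size \<tau> u"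
  using normal_pdf_abs_pos[of u] by (simp add: step_size_def)

lemma pdf_step_size_square:
  assumes "0 < \<tau>" "u \<noteq> 0"
  shows "normal_pdf u * \<bar>u\<bar> * (step_size \<tau> u)\<^sup>2 = 2 * \<tau>"
  using assms normal_density_pos[of 1 0 u] by (simp add: step_size_def)

text \<open>The curvature in the denominator is largest at 1, so the step there is the shortest of
  all.\<close>

lemma step_size_1_le:
  assumes "0 < \<tau>" "u \<noteq> 0"
  shows "step_size \<tau> 1 \<le> step_size \<tau> u"
  unfolding step_size_def
  using assms normal_pdf_abs_pos[of u] normal_pdf_abs_le[of u]
  by (intro real_sqrt_le_mono divide_left_mono) auto

text \<open>Squared, the claim reads \<open>u ^ 3 * normal_pdf u \<le> 2 * \<tau>\<close>. The
  Gaussian factor is split: \<open>exp (- u\<^sup>2 / 16)\<close> is at most \<tau> by the choice of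
  the threshold, and the rest absorbs the cubic factor.\<close>

lemma step_size_ge_self:
  assumes "0 < \<tau>" "\<tau> \<le> 1" "0 < u" "4 * sqrt (ln (1 / \<tau>)) \<le> u"
  shows "u \<le> step_size \<tau> u"
proof -
  have "(4 * sqrt (ln (1 / \<tau>)))\<^sup>2 \<le> u\<^sup>2"
    using assms by (intro power_mono) (auto simp: ln_div)
  then have "16 * ln (1 / \<tau>) \<le> u\<^sup>2"
    using assms by (simp add: power_mult_distrib ln_div)
  then have "- u\<^sup>2 / 16 \<le> ln \<tau>"
    using assms by (simp add: ln_div)
  then have 1: "exp (- u\<^sup>2 / 16) \<le> \<tau>"
    using assms(1) by (metis exp_le_cancel_iff exp_ln)
  \<comment> \<open>Expanding the square and dividing by 8 leaves the constant 49/50, which is below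
    1.\<close>
  have "7 / 10 * u \<le> 1 + u\<^sup>2 / 8"
    using zero_le_power2[of "u - 14 / 5"] by (simp add: power2_eq_square algebra_simps)
  also have "\<dots> \<le> exp (u\<^sup>2 / 8)" by (rule exp_ge_add_one_self)
  finally have "(7 / 10 * u) ^ 3 \<le> exp (u\<^sup>2 / 8) ^ 3"
    using assms by (intro power_mono) auto
  also have "\<dots> = exp (3 * u\<^sup>2 / 8)" by (simp flip: exp_of_nat_mult)
  also have "\<dots> \<le> exp (7 * u\<^sup>2 / 16)" by simp
  \<comment> \<open>The cube of 7/10 is 343/1000, whose inverse is below 4. The 4 later meets the
    1/2 that bounds \<open>1 / sqrt (2 * pi)\<close>, leaving exactly
    \<open>2 * \<tau>\<close>.\<close>
  finally have 2: "u ^ 3 \<le> 4 * exp (7 * u\<^sup>2 / 16)"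
    using exp_gt_zero[of "7 * u\<^sup>2 / 16"] by (simp add: power_mult_distrib power_divide del: exp_gt_zero)
  have "2 \<le> sqrt (2 * pi)"
    using pi_gt3 by (intro real_le_rsqrt) simp
  then have "1 / sqrt (2 * pi) \<le> 1 / 2" by (intro divide_left_mono) auto
  then have "normal_pdf u \<le> 1 / 2 * exp (- u\<^sup>2 / 2)"
    unfolding std_normal_density_def by (intro mult_right_mono) auto
  also have "exp (- u\<^sup>2 / 2) = exp (- u\<^sup>2 / 16) * exp (- (7 * u\<^sup>2 / 16))"
    by (simp flip: exp_add add: field_simps)
  also have "1 / 2 * \<dots> \<le> 1 / 2 * (\<tau> * exp (- (7 * u\<^sup>2 / 16)))"
    using 1 by (intro mult_left_mono mult_right_mono) auto
  finally have "u ^ 3 * normal_pdf u \<le>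
      (4 * exp (7 * u\<^sup>2 / 16)) * (1 / 2 * (\<tau> * exp (- (7 * u\<^sup>2 / 16))))"
    using 2 assms(1,3) by (intro mult_mono) auto
  also have "\<dots> = 2 * \<tau> * (exp (7 * u\<^sup>2 / 16) * exp (- (7 * u\<^sup>2 / 16)))"
    by (simp add: algebra_simps)
  also have "\<dots> = 2 * \<tau>" by (simp flip: exp_add)
  finally have "u\<^sup>2 * (normal_pdf u * \<bar>u\<bar>) \<le> 2 * \<tau>"
    using assms(3) by (simp add: power2_eq_square power3_eq_cube algebra_simps)
  then have "u\<^sup>2 \<le> 2 * \<tau> / (normal_pdf u * \<bar>u\<bar>)"
    using normal_pdf_abs_pos[of u] assms(3) by (subst pos_le_divide_eq) auto
  then show ?thesis
    unfolding step_size_def by (rule real_le_rsqrt)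
qed

section \<open>Tangents and secants of \<Phi> over one step\<close>

lemma normal_cdf_le_tangent:
  assumes "0 \<le> u" "0 \<le> x"
  shows "normal_cdf x \<le> normal_cdf u + normal_pdf u * (x - u)"
proof (rule tangent_error_bounds(1))
  fix t assume "t \<in> closed_segment u x"
  then have "0 \<le> t" using assms by (auto simp: closed_segment_eq_real_ivl split: if_splits)
  then show "- normal_pdf 1 \<le> - (t * normal_pdf t) \<and> - (t * normal_pdf t) \<le> 0"
    using normal_pdf_abs_le[of t] by (simp add: mult.commute)
qed (intro has_real_derivative_normal_cdf has_real_derivative_normal_pdf)+

text \<open>The last hypothesis puts \<open>u\<close> between \<open>x\<close> and 1, so the
  curvature on the segment from \<open>u\<close> to \<open>x\<close> is largest at \<open>u\<close>.
  Within one step of \<open>u\<close> the quadratic error term is then at most \<tau>.\<close>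

lemma tangent_le_normal_cdf:
  assumes "0 < \<tau>" "0 < u" "0 \<le> x" "\<bar>x - u\<bar> \<le> step_size \<tau> u"
    and "x \<le> u \<and> u \<le> 1 \<or> 1 \<le> u \<and> u \<le> x"
  shows "normal_cdf u + normal_pdf u * (x - u) \<le> normal_cdf x + \<tau>"
proof -
  have "normal_cdf u + normal_pdf u * (x - u) \<le>
      normal_cdf x + (normal_pdf u * \<bar>u\<bar>) * (x - u)\<^sup>2 / 2"
  proof (rule tangent_error_bounds(2))
    fix t assume "t \<in> closed_segment u x"
    then have "0 \<le> t" "t \<le> u \<and> u \<le> 1 \<or> 1 \<le> u \<and> u \<le> t"
      using assms by (auto simp: closed_segment_eq_real_ivl split: if_splits)
    then show "- (normal_pdf u * \<bar>u\<bar>) \<le> - (t * normal_pdf t) \<and> - (t * normal_pdf t) \<le> 0"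
      using normal_pdf_abs_mono_le_1[of t u] normal_pdf_abs_antimono_ge_1[of u t]
      by (auto simp: mult.commute)
  qed (intro has_real_derivative_normal_cdf has_real_derivative_normal_pdf)+
  moreover have "(x - u)\<^sup>2 \<le> (step_size \<tau> u)\<^sup>2"
    using assms by (metis abs_ge_zero power2_abs power_mono)
  then have "normal_pdf u * \<bar>u\<bar> * (x - u)\<^sup>2 \<le> normal_pdf u * \<bar>u\<bar> * (step_size \<tau> u)\<^sup>2"
    by (intro mult_left_mono) auto
  ultimately show ?thesis
    using pdf_step_size_square[of \<tau> u] assms by simp
qed

lemma convex_on_normal_cdf: "convex_on {..0} normal_cdf"
  by (rule f''_ge0_imp_convex)
     (auto intro: has_real_derivative_normal_cdf has_real_derivative_normal_pdf
           simp: mult_nonpos_nonneg)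

lemma normal_cdf_le_secant:
  assumes "a < b" "b \<le> 0" "x \<in> {a..b}"
  shows "normal_cdf x \<le> (normal_cdf b - normal_cdf a) / (b - a) * (x - a) + normal_cdf a"
  using assms by (intro convex_onD_Icc' convex_on_subset[OF convex_on_normal_cdf]) auto

text \<open>Here \<open>u\<close> is the end of \<open>{a..b}\<close> nearer to -1, where the
  curvature on the interval is largest. The doubled step cancels against the constant 1/8, again
  giving the error \<tau>.\<close>

lemma secant_le_normal_cdf:
  assumes "0 < \<tau>" "a < b" "b \<le> 0" "x \<in> {a..b}" "u \<noteq> 0" "b - a \<le> 2 * step_size \<tau> u"
    and u: "u = a \<and> - 1 \<le> a \<or> u = b \<and> b \<le> - 1"
  shows "(normal_cdf b - normal_cdf a) / (b - a) * (x - a) + normal_cdf a \<le> normal_cdf x + \<tau>"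
proof -
  have "(normal_cdf b - normal_cdf a) / (b - a) * (x - a) + normal_cdf a \<le>
      normal_cdf x + (normal_pdf u * \<bar>u\<bar>) * (b - a)\<^sup>2 / 8"
  proof (rule secant_error_bounds(2)[OF \<open>a < b\<close> \<open>x \<in> {a..b}\<close>, where f' = normal_pdf])
    fix t assume t: "t \<in> {a..b}"
    then have "t \<le> 0" using assms by auto
    moreover have "normal_pdf t * \<bar>t\<bar> \<le> normal_pdf u * \<bar>u\<bar>"
      using t assms normal_pdf_abs_mono_le_1[of t u] normal_pdf_abs_antimono_ge_1[of u t] by auto
    ultimately show "0 \<le> - (t * normal_pdf t) \<and> - (t * normal_pdf t) \<le> normal_pdf u * \<bar>u\<bar>"
      by (auto simp: mult_nonpos_nonneg mult.commute)
  qed (intro has_real_derivative_normal_cdf has_real_derivative_normal_pdf)+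
  moreover have "(b - a)\<^sup>2 \<le> (2 * step_size \<tau> u)\<^sup>2"
    using assms by (intro power_mono) auto
  then have "normal_pdf u * \<bar>u\<bar> * (b - a)\<^sup>2 \<le> normal_pdf u * \<bar>u\<bar> * (2 * step_size \<tau> u)\<^sup>2"
    by (intro mult_left_mono) auto
  ultimately show ?thesis
    using pdf_step_size_square[of \<tau> u] assms by (simp add: power_mult_distrib)
qed

subsection \<open>The loops of the algorithms\<close>

text \<open>Common form of the four loops: walk to the right from \<open>a\<close> with steps given
  by \<open>r\<close> while staying below \<open>b\<close>. Loops that walk to the left are covered
  by reflection.\<close>

inductive_set march :: "real \<Rightarrow> real \<Rightarrow> (real \<Rightarrow> real) \<Rightarrow> real set" for a b r where
  start: "a \<in> march a b r"
| step: "u \<in> march a b r \<Longrightarrow> u + r u < b \<Longrightarrow> u + r u \<in> march a b r"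

text \<open>Reflection at 0 turns the leftward loop into a rightward one because the step size is
  even.\<close>

lemma tangent_loop1_eq_march: "tangent_loop1 \<tau> = uminus ` march (- 1) 0 (step_size \<tau>)"
proof (intro equalityI subsetI)
  fix u assume "u \<in> tangent_loop1 \<tau>"
  then have "- u \<in> march (- 1) 0 (step_size \<tau>)"
  proof induction
    case (step u)
    then show ?case using march.step[OF step.IH] by simp
  qed (rule march.start)
  then show "u \<in> uminus ` march (- 1) 0 (step_size \<tau>)"
    by (metis image_eqI minus_minus)
next
  fix u assume "u \<in> uminus ` march (- 1) 0 (step_size \<tau>)"
  then obtain v where "v \<in> march (- 1) 0 (step_size \<tau>)" and u: "u = - v" by blast
  from this(1) show "u \<in> tangent_loop1 \<tau>" unfolding u
  proof induction
    case start
    show ?case using tangent_loop1.start by simp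
  next
    case (step v)
    then show ?case using tangent_loop1.step[OF step.IH] by simp
  qed
qed

lemma tangent_loop2_eq_march: "tangent_loop2 zR \<tau> = march 1 zR (step_size \<tau>)"
proof (intro equalityI subsetI)
  fix u assume "u \<in> tangent_loop2 zR \<tau>"
  then show "u \<in> march 1 zR (step_size \<tau>)"
    by induction (auto intro: march.intros)
next
  fix u assume "u \<in> march 1 zR (step_size \<tau>)"
  then show "u \<in> tangent_loop2 zR \<tau>"
    by induction (auto intro: tangent_loop2.intros)
qed

lemma secant_loop1_eq_march: "secant_loop1 \<tau> = march (- 1) 0 (\<lambda>u. 2 * step_size \<tau> u)"
proof (intro equalityI subsetI)
  fix u assume "u \<in> secant_loop1 \<tau>"
  then show "u \<in> march (- 1) 0 (\<lambda>u. 2 * step_size \<tau> u)"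
  proof induction
    case (step u)
    then show ?case using march.step[OF step.IH] by simp
  qed (rule march.start)
next
  fix u assume "u \<in> march (- 1) 0 (\<lambda>u. 2 * step_size \<tau> u)"
  then show "u \<in> secant_loop1 \<tau>"
    by induction (auto intro: secant_loop1.intros)
qed

lemma secant_loop2_eq_march:
  "secant_loop2 zL \<tau> = uminus ` march 1 (- zL) (\<lambda>u. 2 * step_size \<tau> u)"
proof (intro equalityI subsetI)
  fix u assume "u \<in> secant_loop2 zL \<tau>"
  then have "- u \<in> march 1 (- zL) (\<lambda>u. 2 * step_size \<tau> u)"
  proof induction
    case start
    show ?case using march.start[of 1] by simp
  next
    case (step u)
    then show ?case using march.step[OF step.IH] by simp
  qed
  then show "u \<in> uminus ` march 1 (- zL) (\<lambda>u. 2 * step_size \<tau> u)"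
    by (metis image_eqI minus_minus)
next
  fix u assume "u \<in> uminus ` march 1 (- zL) (\<lambda>u. 2 * step_size \<tau> u)"
  then obtain v where "v \<in> march 1 (- zL) (\<lambda>u. 2 * step_size \<tau> u)" and u: "u = - v" by blast
  from this(1) show "u \<in> secant_loop2 zL \<tau>" unfolding u
  proof induction
    case (step v)
    then show ?case using secant_loop2.step[OF step.IH] by simp
  qed (rule secant_loop2.start)
qed

section \<open>Range, covering and counting of a march\<close>

lemma march_bounds:
  assumes "a < b" and nonneg: "\<And>u. a \<le> u \<Longrightarrow> u < b \<Longrightarrow> 0 \<le> r u"
    and "u \<in> march a b r"
  shows "a \<le> u" "u < b"
proof -
  from assms(3) have "a \<le> u \<and> u < b"
  proof induction
    case (step u)
    then show ?case using nonneg[of u] by simp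
  qed (use \<open>a < b\<close> in simp)
  then show "a \<le> u" "u < b" by simp_all
qed

text \<open>The witness is the largest visited point up to \<open>x\<close>. Its successor either
  lies beyond \<open>x\<close> or was rejected for reaching \<open>b\<close>; otherwise it would be
  a larger candidate.\<close>

lemma march_cover:
  assumes "finite (march a b r)" "a \<le> x" and pos: "\<And>u. u \<in> march a b r \<Longrightarrow> 0 < r u"
  obtains u where "u \<in> march a b r" "u \<le> x" "x < u + r u \<or> b \<le> u + r u"
proof -
  define u where "u = Max {v \<in> march a b r. v \<le> x}"
  have fin: "finite {v \<in> march a b r. v \<le> x}" using assms by simp
  moreover have "{v \<in> march a b r. v \<le> x} \<noteq> {}"
    using \<open>a \<le> x\<close> march.start by blast
  ultimately have "u \<in> {v \<in> march a b r. v \<le> x}"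
    unfolding u_def by (rule Max_in)
  then have u: "u \<in> march a b r" "u \<le> x" by simp_all
  have "x < u + r u \<or> b \<le> u + r u"
  proof (rule ccontr)
    assume "\<not> ?thesis"
    then have "u + r u \<in> {v \<in> march a b r. v \<le> x}"
      using u(1) by (auto intro: march.step)
    then have "u + r u \<le> u" unfolding u_def by (intro Max_ge fin)
    then show False using pos[OF u(1)] by simp
  qed
  with u show ?thesis by (rule that)
qed

text \<open>A potential argument: \<open>F\<close> gains at least 1 in each step and never exceeds
  \<open>M\<close>, so at most \<open>M - F a\<close> steps are made. The extra 1 counts the
  starting point. Finiteness, hence termination of the loop, comes with it.\<close>

lemma march_finite_card:
  assumes step: "\<And>u. u \<in> march a b r \<Longrightarrow> u + r u < b \<Longrightarrow> F u + 1 \<le> F (u + r u)"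
    and bound: "\<And>u. u \<in> march a b r \<Longrightarrow> F u \<le> M"
  shows "finite (march a b r)" "real (card (march a b r)) \<le> M - F a + 1"
proof -
  define N where "N = nat \<lfloor>M - F a\<rfloor>"
  have sub: "march a b r \<subseteq> (\<lambda>n. ((\<lambda>u. u + r u) ^^ n) a) ` {..N}"
  proof
    fix u assume u: "u \<in> march a b r"
    then have "\<exists>n. u = ((\<lambda>u. u + r u) ^^ n) a \<and> F a + real n \<le> F u"
    proof induction
      case start
      show ?case by (intro exI[of _ 0]) simp
    next
      case (step u)
      then obtain n where "u = ((\<lambda>u. u + r u) ^^ n) a" "F a + real n \<le> F u" by blast
      then show ?case using assms(1)[OF step.hyps] by (intro exI[of _ "Suc n"]) auto
    qed
    then obtain n where n: "u = ((\<lambda>u. u + r u) ^^ n) a" "F a + real n \<le> F u" by blast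
    with bound[OF u] have "n \<le> N" unfolding N_def by (simp add: le_nat_floor)
    with n show "u \<in> (\<lambda>n. ((\<lambda>u. u + r u) ^^ n) a) ` {..N}" by blast
  qed
  then show "finite (march a b r)" by (rule finite_subset) simp
  have "card (march a b r) \<le> card ((\<lambda>n. ((\<lambda>u. u + r u) ^^ n) a) ` {..N})"
    by (rule card_mono[OF _ sub]) simp
  also have "\<dots> \<le> N + 1" using card_image_le[of "{..N}"] by simp
  finally have "real (card (march a b r)) \<le> real N + 1" by simp
  moreover have "0 \<le> M - F a" using bound[OF march.start] by simp
  then have "real N \<le> M - F a" unfolding N_def by simp
  ultimately show "real (card (march a b r)) \<le> M - F a + 1" by simp
qed

text \<open>The potential is the position measured in units of the minimal step length
  \<open>d\<close>.\<close>

lemma march_finite_card_linear: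
  assumes "a < b" "0 < d" and d: "\<And>u. a \<le> u \<Longrightarrow> u < b \<Longrightarrow> d \<le> r u"
  shows "finite (march a b r)" "real (card (march a b r)) \<le> (b - a) / d + 1"
proof -
  have bounds: "a \<le> u" "u < b" if "u \<in> march a b r" for u
    using march_bounds[OF \<open>a < b\<close> _ that] d \<open>0 < d\<close> by (meson less_le_trans less_imp_le)+
  have 1: "u / d + 1 \<le> (u + r u) / d" if "u \<in> march a b r" for u
    using d[OF bounds[OF that]] \<open>0 < d\<close> by (simp add: field_simps)
  have 2: "u / d \<le> b / d" if "u \<in> march a b r" for u
    using bounds[OF that] \<open>0 < d\<close> by (simp add: divide_right_mono)
  show "finite (march a b r)"
    by (rule march_finite_card[of a b r "\<lambda>u. u / d", OF 1 2])
  show "real (card (march a b r)) \<le> (b - a) / d + 1"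
    using march_finite_card(2)[of a b r "\<lambda>u. u / d", OF 1 2] by (simp add: diff_divide_distrib)
qed

text \<open>Beyond \<open>T\<close> every step at least doubles the current point. The potential therefore counts
  steps of length \<open>d\<close> up to \<open>T\<close> and doublings afterwards; its jump by \<open>1\<close> at \<open>T\<close> pays for the
  step that crosses \<open>T\<close>.\<close>

lemma march_card_doubling:
  assumes "1 < b" "0 < d" "1 \<le> T" and d: "\<And>u. 1 \<le> u \<Longrightarrow> u < b \<Longrightarrow> d \<le> r u"
    and T: "\<And>u. T \<le> u \<Longrightarrow> u < b \<Longrightarrow> u \<le> r u"
  shows "real (card (march 1 b r)) \<le> T / d + 2 + log 2 b"
proof -
  have bounds: "1 \<le> u" "u < b" if "u \<in> march 1 b r" for u
    using march_bounds[OF \<open>1 < b\<close> _ that] d \<open>0 < d\<close> by (meson less_le_trans less_imp_le)+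
  define F where "F u = (if u < T then u / d else T / d + 1 + log 2 u)" for u
  have 1: "F u + 1 \<le> F (u + r u)" if u: "u \<in> march 1 b r" for u
  proof -
    note b = bounds[OF u] and r = d[OF bounds[OF u]]
    consider "u + r u < T" | "u < T" "T \<le> u + r u" | "T \<le> u" by linarith
    then show ?thesis
    proof cases
      case 1
      then have "u < T" using r \<open>0 < d\<close> by linarith
      with 1 r \<open>0 < d\<close> show ?thesis by (simp add: F_def field_simps)
    next
      case 2
      then have "u / d \<le> T / d" using \<open>0 < d\<close> by (simp add: divide_right_mono)
      moreover have "0 \<le> log 2 (u + r u)" using 2 \<open>1 \<le> T\<close> by simp
      ultimately show ?thesis using 2 by (simp add: F_def)
    next
      case 3
      have "log 2 u + 1 = log 2 (2 * u)" using b by (simp add: log_mult)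
      also have "\<dots> \<le> log 2 (u + r u)" using b T[OF 3] by simp
      finally show ?thesis using 3 r \<open>0 < d\<close> by (simp add: F_def)
    qed
  qed
  have 2: "F u \<le> T / d + 1 + log 2 b" if "u \<in> march 1 b r" for u
  proof (cases "u < T")
    case True
    moreover have "0 \<le> log 2 b" using \<open>1 < b\<close> by simp
    moreover have "u / d \<le> T / d" using True \<open>0 < d\<close> by (simp add: divide_right_mono)
    ultimately show ?thesis by (simp add: F_def)
  next
    case False
    then show ?thesis using bounds[OF that] \<open>1 \<le> T\<close> by (simp add: F_def)
  qed
  have "0 \<le> F 1" using \<open>1 \<le> T\<close> \<open>0 < d\<close> by (simp add: F_def)
  with march_finite_card(2)[of 1 b r F, OF 1 2] show ?thesis by simp
qed

subsection \<open>Arrays of breakpoints and the outer approximation\<close>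

text \<open>In a strictly sorted list the entries before an element are exactly the smaller
  elements, so their number is its index. This is what places 0 at index 0 of the shifted
  array.\<close>

lemma nth_sorted_list_of_set_card:
  fixes A :: "'a :: linorder set"
  assumes "finite A" "a \<in> A"
  shows "sorted_list_of_set A ! card {y \<in> A. y < a} = a"
proof -
  let ?xs = "sorted_list_of_set A"
  have sorted: "sorted_wrt (<) ?xs" by simp
  from assms obtain j where j: "j < length ?xs" "?xs ! j = a"
    by (metis in_set_conv_nth set_sorted_list_of_set)
  have "{y \<in> A. y < a} = (!) ?xs ` {..<j}"
  proof (intro equalityI subsetI)
    fix y assume y: "y \<in> {y \<in> A. y < a}"
    then obtain i where i: "i < length ?xs" "?xs ! i = y"
      using assms(1) by (metis in_set_conv_nth mem_Collect_eq set_sorted_list_of_set)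
    have "i < j"
      using sorted_wrt_nth_less[OF sorted, of j i] i j y
      by (metis linorder_neqE_nat mem_Collect_eq order_less_asym order_less_irrefl)
    with i show "y \<in> (!) ?xs ` {..<j}" by blast
  next
    fix y assume "y \<in> (!) ?xs ` {..<j}"
    then obtain i where i: "i < j" "y = ?xs ! i" by blast
    then have "y < a" using sorted_wrt_nth_less[OF sorted i(1) j(1)] j(2) by simp
    moreover have "y \<in> A"
      using i j assms(1) by (metis nth_mem order_less_trans set_sorted_list_of_set)
    ultimately show "y \<in> {y \<in> A. y < a}" by simp
  qed
  moreover have "inj_on ((!) ?xs) {..<j}"
    using j(1) by (intro inj_on_nth) auto
  ultimately have "card {y \<in> A. y < a} = j" by (simp add: card_image)
  with j show ?thesis by simp
qed

lemma breakpoint_array: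
  assumes A: "finite A" "0 \<in> A" "zL \<in> A" "zR \<in> A" "zL < 0" "0 < zR" "A \<subseteq> {zL..zR}"
  defines "I \<equiv> {- int (num_left A)..int (num_right A)}"
  shows valid_breakpoints_array:
      "valid_breakpoints zL zR (num_left A) (num_right A) (breakpoint_array A)"
    and breakpoint_array_image: "breakpoint_array A ` I = A"
proof -
  let ?xs = "sorted_list_of_set A" and ?L = "num_left A" and ?R = "num_right A"
  let ?z = "breakpoint_array A"
  \<comment> \<open>Splitting at 0 gives the list length \<open>?L + ?R + 1\<close>, so the shifted
    indices from \<open>- ?L\<close> to \<open>?R\<close> run exactly through the list.\<close>
  have "A = {a \<in> A. a < 0} \<union> ({0} \<union> {a \<in> A. a > 0})" using A by auto
  then have "card A = card ({a \<in> A. a < 0} \<union> ({0} \<union> {a \<in> A. a > 0}))" by simp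
  also have "\<dots> = ?L + (1 + ?R)"
    using A unfolding num_left_def num_right_def by (subst card_Un_disjoint; auto)+
  finally have len: "length ?xs = ?L + ?R + 1" by simp
  have mono: "strict_mono_on I ?z"
  proof (rule strict_mono_onI)
    fix i j assume "i \<in> I" "j \<in> I" "i < j"
    then show "?z i < ?z j"
      unfolding breakpoint_array_def I_def using len
      by (intro sorted_wrt_nth_less[OF strict_sorted_list_of_set]) auto
  qed
  show image: "?z ` I = A"
  proof (intro equalityI subsetI)
    fix a assume "a \<in> ?z ` I"
    then obtain i where "i \<in> I" "a = ?z i" by blast
    then have "a \<in> set ?xs" using len
      unfolding breakpoint_array_def I_def by (auto intro!: nth_mem)
    then show "a \<in> A" using A by simp
  next
    fix a assume "a \<in> A"
    then obtain j where "j < length ?xs" "?xs ! j = a"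
      using A by (metis in_set_conv_nth set_sorted_list_of_set)
    then have "?z (int j - int ?L) = a" "int j - int ?L \<in> I"
      using len by (auto simp: breakpoint_array_def I_def)
    then show "a \<in> ?z ` I" by blast
  qed
  have pos: "0 < ?L" "0 < ?R"
    using A unfolding num_left_def num_right_def by (auto simp: card_gt_0_iff)
  have mono_le: "?z i \<le> ?z j" if "i \<in> I" "j \<in> I" "i \<le> j" for i j
    using strict_mono_onD[OF mono that(1,2)] that(3) by (cases "i = j") auto
  have ends: "- int ?L \<in> I" "int ?R \<in> I" by (auto simp: I_def)
  then have ends_A: "?z (- int ?L) \<in> A" "?z (int ?R) \<in> A" using image by blast+
  obtain i j where "i \<in> I" "?z i = zL" "j \<in> I" "?z j = zR" using A image by (metis imageE)
  then have "?z (- int ?L) \<le> zL" "zR \<le> ?z (int ?R)"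
    using mono_le[OF ends(1)] mono_le[OF _ ends(2)] by (auto simp: I_def)
  then have "?z (- int ?L) = zL" "?z (int ?R) = zR"
    using ends_A \<open>A \<subseteq> {zL..zR}\<close> by force+
  moreover have "?z 0 = 0"
    using nth_sorted_list_of_set_card[OF A(1,2)] by (simp add: breakpoint_array_def num_left_def)
  ultimately show "valid_breakpoints zL zR ?L ?R ?z"
    using mono pos by (simp add: valid_breakpoints_def I_def)
qed

text \<open>For a minimum of tangents, one good tangent at each \<open>x\<close> gives the upper
  bound, while concavity puts all of them above \<Phi>. For a maximum of secants the roles change:
  all must stay below \<Phi> + \<tau>, and the one whose interval contains \<open>x\<close> gives
  the lower bound. Beyond the end points the constants 1 and \<open>normal_cdf zL\<close> take
  over.\<close>

lemma outer_approx_bounds: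
  assumes valid: "valid_breakpoints zL zR L R z"
    and A: "A = z ` {- int L..int R}"
    and tails: "1 - normal_cdf zR \<le> \<tau>" "normal_cdf zL \<le> \<tau>"
    and tangent: "\<And>x. 0 \<le> x \<Longrightarrow> x \<le> zR \<Longrightarrow>
      \<exists>u\<in>A. 0 \<le> u \<and> normal_cdf u + normal_pdf u * (x - u) \<le> normal_cdf x + \<tau>"
    and secant: "\<And>a b x. a \<in> A \<Longrightarrow> b \<in> A \<Longrightarrow> a < b \<Longrightarrow> b \<le> 0 \<Longrightarrow> A \<inter> {a<..<b} = {} \<Longrightarrow>
      x \<in> {a..b} \<Longrightarrow>
      (normal_cdf b - normal_cdf a) / (b - a) * (x - a) + normal_cdf a \<le> normal_cdf x + \<tau>"
  shows "0 \<le> outer_approx L R z x - normal_cdf x \<and> outer_approx L R z x - normal_cdf x \<le> \<tau>"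
proof -
  from valid have LR: "0 < L" "0 < R" and mono: "strict_mono_on {- int L..int R} z"
    and z: "z (- int L) = zL" "z 0 = 0" "z (int R) = zR"
    by (auto simp: valid_breakpoints_def)
  have z_less: "z i < z j \<longleftrightarrow> i < j" if "i \<in> {- int L..int R}" "j \<in> {- int L..int R}" for i j
    using strict_mono_on_less[OF mono that] .
  have z_le: "z i \<le> z j \<longleftrightarrow> i \<le> j" if "i \<in> {- int L..int R}" "j \<in> {- int L..int R}" for i j
    using strict_mono_on_less_eq[OF mono that] .
  have "0 \<le> \<tau>" using tails(2) normal_cdf_pos[of zL] by linarith
  show ?thesis
  proof (cases "0 \<le> x")
    case True
    let ?g = "\<lambda>i. tangent_slope z i * x + tangent_intercept z i"
    let ?m = "MIN i\<in>{0..R}. ?g i"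
    have line: "?g i = normal_cdf u + normal_pdf u * (x - u)" if "u = z (int i)" for u i
      using that by (simp add: tangent_slope_def tangent_intercept_def algebra_simps)
    have "normal_cdf x \<le> ?g i" if "i \<in> {0..R}" for i
      unfolding line[OF refl]
      using that True z_le[of 0 "int i"] z(2) by (intro normal_cdf_le_tangent) auto
    then have "normal_cdf x \<le> ?m" by (intro Min.boundedI) auto
    then have lower: "normal_cdf x \<le> outer_approx L R z x"
      using True std_normal.cdf_bounded_prob[of x] by (simp add: outer_approx_def)
    have "min 1 ?m \<le> normal_cdf x + \<tau>"
    proof (cases "x \<le> zR")
      case le: True
      from tangent[OF True le] obtain u where u: "u \<in> A" "0 \<le> u"
        "normal_cdf u + normal_pdf u * (x - u) \<le> normal_cdf x + \<tau>" by blast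
      then obtain i where i: "i \<in> {- int L..int R}" "u = z i" unfolding A by blast
      then have "0 \<le> i" using u(2) z_le[of 0 i] z(2) by simp
      then have "?g (nat i) \<le> normal_cdf x + \<tau>" using u(3) i by (subst line[of u]) auto
      moreover have "?m \<le> ?g (nat i)"
        using i \<open>0 \<le> i\<close> by (intro Min_le imageI finite_imageI) auto
      ultimately show ?thesis by linarith
    next
      case False
      then have "1 \<le> normal_cdf x + \<tau>" using tails(1) normal_cdf_mono[of zR x] by simp
      then show ?thesis by linarith
    qed
    with lower True show ?thesis by (simp add: outer_approx_def)
  next
    case False
    then have "x < 0" by simp
    let ?h = "\<lambda>i. secant_slope z i * x + secant_intercept z i"
    let ?m = "MAX i\<in>{1..L}. ?h i"
    have line: "?h i = (normal_cdf b - normal_cdf a) / (b - a) * (x - a) + normal_cdf a"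
      if "a = z (- int i)" "b = z (- int i + 1)" for a b i
      unfolding that secant_intercept_def secant_slope_def[symmetric]
      by (simp add: right_diff_distrib)
    have ends: "z (- int i) < z (- int i + 1)" "z (- int i + 1) \<le> 0" if "i \<in> {1..L}" for i
      using that z_less[of "- int i" "- int i + 1"] z_le[of "- int i + 1" 0] z(2) by auto
    have "?h i \<le> normal_cdf x + \<tau>" if i: "i \<in> {1..L}" for i
    proof -
      define a b where "a = z (- int i)" and "b = z (- int i + 1)"
      note ab = ends[OF i, folded a_def b_def]
      show ?thesis
      proof (cases "x \<in> {a..b}")
        case True
        have "a \<in> A" "b \<in> A" unfolding A a_def b_def using i by (auto intro!: imageI)
        moreover have "A \<inter> {a<..<b} = {}"
        proof -
          have "z k \<notin> {a<..<b}" if "k \<in> {- int L..int R}" for k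
            using that i z_less[of "- int i" k] z_less[of k "- int i + 1"]
            by (auto simp: a_def b_def)
          then show ?thesis unfolding A by blast
        qed
        ultimately show ?thesis
          unfolding line[OF a_def b_def] using ab True secant[of a b x] by metis
      next
        case False
        then have "?h i \<le> normal_cdf x"
          unfolding line[OF a_def b_def] using ab \<open>x < 0\<close>
          by (intro convex_on_secant_le[where I = "{..0}"] convex_on_normal_cdf) auto
        with \<open>0 \<le> \<tau>\<close> show ?thesis by linarith
      qed
    qed
    then have "?m \<le> normal_cdf x + \<tau>" using LR by (intro Max.boundedI) auto
    moreover have "zL \<le> x \<Longrightarrow> normal_cdf x \<le> ?m"
    proof -
      assume "zL \<le> x"
      let ?K = "{k \<in> {- int L..0}. z k \<le> x}"
      \<comment> \<open>The last breakpoint up to \<open>x\<close> is the left end of the interval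
        that contains \<open>x\<close>.\<close>
      define k where "k = Max ?K"
      have fin: "finite ?K" by (rule finite_subset[of _ "{- int L..0}"]) auto
      moreover have "?K \<noteq> {}" using z(1) \<open>zL \<le> x\<close> by fastforce
      ultimately have k: "k \<in> ?K" unfolding k_def by (rule Max_in)
      then have "k < 0" using z(2) \<open>x < 0\<close> by (cases "k = 0") auto
      have "x < z (k + 1)"
      proof (rule ccontr)
        assume "\<not> ?thesis"
        then have "k + 1 \<in> ?K" using k \<open>k < 0\<close> by auto
        then have "k + 1 \<le> k" unfolding k_def by (rule Max_ge[OF fin])
        then show False by simp
      qed
      define i where "i = nat (- k)"
      have i: "i \<in> {1..L}" "k = - int i" using k \<open>k < 0\<close> by (auto simp: i_def)
      then have "normal_cdf x \<le> ?h i"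
        unfolding line[OF refl refl] using ends[of i] \<open>x < z (k + 1)\<close> k
        by (intro normal_cdf_le_secant) auto
      also have "\<dots> \<le> ?m" using i by (intro Max_ge imageI finite_imageI) auto
      finally show ?thesis .
    qed
    \<comment> \<open>The constant \<open>normal_cdf zL\<close> is at most \<tau>, so including it
      in the maximum keeps the upper bound; left of \<open>zL\<close> it dominates \<Phi> by
      monotonicity.\<close>
    ultimately show ?thesis
      using False z(1) tails(2) normal_cdf_mono[of x zL] std_normal.cdf_nonneg[of x]
      by (cases "zL \<le> x") (auto simp: outer_approx_def max_def)
  qed
qed

subsection \<open>The breakpoints of the two algorithms\<close>

context
  fixes \<tau> zL zR :: real
  assumes \<tau>: "0 < \<tau>" and zL: "zL < - 1" and zR: "1 < zR"
begin

lemma breakpoints_eq_march: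
  "breakpoints zL zR \<tau> =
    march (- 1) 0 (\<lambda>u. 2 * step_size \<tau> u) \<union> uminus ` march 1 (- zL) (\<lambda>u. 2 * step_size \<tau> u) \<union>
    {zL} \<union> (uminus ` march (- 1) 0 (step_size \<tau>) \<union> {0} \<union> march 1 zR (step_size \<tau>) \<union> {zR})"
  by (simp add: breakpoints_def secant_points_def tangent_points_def secant_loop1_eq_march
      secant_loop2_eq_march tangent_loop1_eq_march tangent_loop2_eq_march)

lemma step_1_pos: "0 < step_size \<tau> 1"
  using step_size_pos[OF \<tau>] by simp

lemma step_1_le: "u \<noteq> 0 \<Longrightarrow> step_size \<tau> 1 \<le> step_size \<tau> u" "u \<noteq> 0 \<Longrightarrow> step_size \<tau> 1 \<le> 2 * step_size \<tau> u"
  using step_size_1_le[OF \<tau>, of u] step_1_pos by simp_all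

lemma finite_marches:
  "finite (march (- 1) 0 (step_size \<tau>))" "finite (march 1 zR (step_size \<tau>))"
  "finite (march (- 1) 0 (\<lambda>u. 2 * step_size \<tau> u))" "finite (march 1 (- zL) (\<lambda>u. 2 * step_size \<tau> u))"
  by (intro march_finite_card_linear(1)[OF _ step_1_pos] step_1_le; use zL zR in simp)+

lemma finite_breakpoints: "finite (breakpoints zL zR \<tau>)"
  unfolding breakpoints_eq_march by (simp add: finite_marches)

lemma march_mem_range:
  "u \<in> march (- 1) 0 (step_size \<tau>) \<Longrightarrow> - 1 \<le> u \<and> u < 0"
  "u \<in> march 1 zR (step_size \<tau>) \<Longrightarrow> 1 \<le> u \<and> u < zR"
  "u \<in> march (- 1) 0 (\<lambda>u. 2 * step_size \<tau> u) \<Longrightarrow> - 1 \<le> u \<and> u < 0"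
  "u \<in> march 1 (- zL) (\<lambda>u. 2 * step_size \<tau> u) \<Longrightarrow> 1 \<le> u \<and> u < - zL"
proof -
  have nonneg: "0 \<le> step_size \<tau> u" for u using \<tau> by (simp add: step_size_def)
  have range: "a \<le> u \<and> u < b" if "a < b" "\<And>u. 0 \<le> r u" "u \<in> march a b r" for a b r
    using march_bounds[OF that(1,2,3)] by simp
  show "u \<in> march (- 1) 0 (step_size \<tau>) \<Longrightarrow> - 1 \<le> u \<and> u < 0"
    "u \<in> march 1 zR (step_size \<tau>) \<Longrightarrow> 1 \<le> u \<and> u < zR"
    "u \<in> march (- 1) 0 (\<lambda>u. 2 * step_size \<tau> u) \<Longrightarrow> - 1 \<le> u \<and> u < 0"
    "u \<in> march 1 (- zL) (\<lambda>u. 2 * step_size \<tau> u) \<Longrightarrow> 1 \<le> u \<and> u < - zL"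
    by (rule range; use zL zR nonneg in simp)+
qed

lemma breakpoints_subset: "breakpoints zL zR \<tau> \<subseteq> {zL..zR}"
  unfolding breakpoints_eq_march using zL zR by (auto dest!: march_mem_range)

lemma breakpoints_tangent:
  assumes x: "0 \<le> x" "x \<le> zR"
  shows "\<exists>u\<in>breakpoints zL zR \<tau>. 0 \<le> u \<and>
    normal_cdf u + normal_pdf u * (x - u) \<le> normal_cdf x + \<tau>"
proof (cases "1 \<le> x")
  case True
  have "0 < step_size \<tau> u" if "u \<in> march 1 zR (step_size \<tau>)" for u
    using march_mem_range(2)[OF that] by (intro step_size_pos[OF \<tau>]) auto
  from march_cover[OF finite_marches(2) True this]
  obtain u where u: "u \<in> march 1 zR (step_size \<tau>)" "u \<le> x"
    "x < u + step_size \<tau> u \<or> zR \<le> u + step_size \<tau> u" by blast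
  then have "1 \<le> u" using march_mem_range(2) by simp
  \<comment> \<open>If the loop stopped at \<open>u\<close>, then \<open>x\<close> is still within
    one step of \<open>u\<close>, because \<open>x \<le> zR\<close>.\<close>
  then have "normal_cdf u + normal_pdf u * (x - u) \<le> normal_cdf x + \<tau>"
    using u x by (intro tangent_le_normal_cdf[OF \<tau>]) auto
  then show ?thesis
    using u(1) \<open>1 \<le> u\<close> by (intro bexI[of _ u]) (auto simp: breakpoints_eq_march)
next
  case False
  have "0 < step_size \<tau> u" if "u \<in> march (- 1) 0 (step_size \<tau>)" for u
    using march_mem_range(1)[OF that] by (intro step_size_pos[OF \<tau>]) auto
  from march_cover[OF finite_marches(1) _ this, of "- x"] False
  obtain v where v: "v \<in> march (- 1) 0 (step_size \<tau>)" "v \<le> - x"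
    "- x < v + step_size \<tau> v \<or> 0 \<le> v + step_size \<tau> v" by auto
  then have "- 1 \<le> v" "v < 0" using march_mem_range(1) by simp_all
  then have "normal_cdf (- v) + normal_pdf (- v) * (x - - v) \<le> normal_cdf x + \<tau>"
    using v x by (intro tangent_le_normal_cdf[OF \<tau>]) auto
  then show ?thesis
    using v(1) \<open>v < 0\<close> by (intro bexI[of _ "- v"]) (auto simp: breakpoints_eq_march)
qed

text \<open>Since -1 is a breakpoint, two consecutive ones lie on the same side of it. The one
  nearer to -1 was visited by a secant loop, and its successor cannot fall strictly between them, so
  their distance is at most one doubled step. This includes the last intervals, which end at 0 or
  \<open>zL\<close>.\<close>

lemma breakpoints_secant:
  assumes ab: "a \<in> breakpoints zL zR \<tau>" "b \<in> breakpoints zL zR \<tau>" "a < b" "b \<le> 0"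
    and gap: "breakpoints zL zR \<tau> \<inter> {a<..<b} = {}" and x: "x \<in> {a..b}"
  shows "(normal_cdf b - normal_cdf a) / (b - a) * (x - a) + normal_cdf a \<le> normal_cdf x + \<tau>"
proof -
  let ?S1 = "march (- 1) 0 (\<lambda>u. 2 * step_size \<tau> u)"
  let ?S2 = "march 1 (- zL) (\<lambda>u. 2 * step_size \<tau> u)"
  \<comment> \<open>The points of the tangent algorithm are nonnegative and so never split an
    interval of the negative half-line.\<close>
  have mem: "u \<in> ?S1 \<or> - u \<in> ?S2 \<or> u = zL \<or> 0 \<le> u" if "u \<in> breakpoints zL zR \<tau>" for u
    using that zR by (auto simp: breakpoints_eq_march dest!: march_mem_range(1,2))
  have no_gap: "\<not> (a < u \<and> u < b)" if "u \<in> breakpoints zL zR \<tau>" for u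
    using that gap by auto
  show ?thesis
  proof (cases "- 1 \<le> a")
    case True
    have "a \<in> ?S1"
    proof -
      have "a = - 1" if "- a \<in> ?S2" using march_mem_range(4)[OF that] True by simp
      then show ?thesis using mem[OF ab(1)] True ab zL march.start[of "- 1" 0] by auto
    qed
    have "b \<le> a + 2 * step_size \<tau> a"
    proof (rule ccontr)
      assume *: "\<not> ?thesis"
      then have "a + 2 * step_size \<tau> a \<in> ?S1"
        using march.step[OF \<open>a \<in> ?S1\<close>] ab(4) by simp
      moreover have "0 < step_size \<tau> a" using ab by (intro step_size_pos[OF \<tau>]) auto
      ultimately show False using no_gap[of "a + 2 * step_size \<tau> a"] *
        by (auto simp: breakpoints_eq_march)
    qed
    then show ?thesis
      using ab x True by (intro secant_le_normal_cdf[where u = a] \<tau>) auto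
  next
    case False
    have "- 1 \<in> breakpoints zL zR \<tau>" by (simp add: breakpoints_eq_march march.start)
    then have "b \<le> - 1" using no_gap[of "- 1"] False by auto
    have "zL \<le> a" using ab breakpoints_subset by auto
    have "- b \<in> ?S2"
    proof -
      have "b = - 1" if "b \<in> ?S1" using march_mem_range(3)[OF that] \<open>b \<le> - 1\<close> by simp
      then show ?thesis
        using mem[OF ab(2)] \<open>b \<le> - 1\<close> \<open>zL \<le> a\<close> ab(3) march.start[of 1] by auto
    qed
    have "b - 2 * step_size \<tau> b \<le> a"
    proof (rule ccontr)
      assume *: "\<not> ?thesis"
      then have "- b + 2 * step_size \<tau> b \<in> ?S2"
        using march.step[OF \<open>- b \<in> ?S2\<close>] \<open>zL \<le> a\<close> by simp
      then have "- (- b + 2 * step_size \<tau> b) \<in> breakpoints zL zR \<tau>"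
        unfolding breakpoints_eq_march by blast
      moreover have "0 < step_size \<tau> b" using \<open>b \<le> - 1\<close> by (intro step_size_pos[OF \<tau>]) auto
      ultimately show False using no_gap[of "- (- b + 2 * step_size \<tau> b)"] * by auto
    qed
    then show ?thesis
      using ab x \<open>b \<le> - 1\<close> by (intro secant_le_normal_cdf[where u = b] \<tau>) auto
  qed
qed

text \<open>The loops inside \<open>{- 1..1}\<close> cost a multiple of
  \<open>1 / step_size \<tau> 1\<close>; the outer loops also cost the length up to the threshold
  and a logarithm of the end point, which \<open>K\<close> controls. As
  \<open>\<tau> \<le> exp (- 1)\<close>, both \<open>1\<close> and \<open>sqrt (1 / \<tau>)\<close>
  are at most \<open>Q\<close>.\<close>

lemma card_breakpoints_le:
  assumes "\<tau> \<le> exp (- 1)"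
  defines "Q \<equiv> sqrt (1 / \<tau> * ln (1 / \<tau>))"
  assumes K: "ln (max \<bar>zL\<bar> zR) \<le> K * Q"
  shows "real (card (breakpoints zL zR \<tau>)) \<le> (19 + 4 * K) * Q"
proof -
  define d T where "d = step_size \<tau> 1" and "T = 4 * sqrt (ln (1 / \<tau>))"
  have "\<tau> \<le> 1" using assms(1) by (rule order_trans) simp
  have ln: "1 \<le> ln (1 / \<tau>)"
    using assms(1) \<tau> ln_mono[of \<tau> "exp (- 1)"] by (simp add: ln_div)
  then have sqrt_ln: "1 \<le> sqrt (ln (1 / \<tau>))" by simp
  have Q: "Q = sqrt (1 / \<tau>) * sqrt (ln (1 / \<tau>))"
    unfolding Q_def by (rule real_sqrt_mult)
  have sqrt_\<tau>: "1 \<le> sqrt (1 / \<tau>)" using \<tau> \<open>\<tau> \<le> 1\<close> by simp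
  have "sqrt (1 / \<tau>) \<le> Q"
    unfolding Q using sqrt_\<tau> mult_left_mono[OF sqrt_ln, of "sqrt (1 / \<tau>)"] by linarith
  then have "1 \<le> Q" using sqrt_\<tau> by linarith
  have "normal_pdf 1 \<le> 1"
  proof -
    have "1 \<le> sqrt (2 * pi)" using pi_gt3 by (intro real_le_rsqrt) simp
    then have "1 / sqrt (2 * pi) \<le> 1" by simp
    then have "1 / sqrt (2 * pi) * exp (- 1\<^sup>2 / 2) \<le> 1 * 1" by (intro mult_mono) auto
    then show ?thesis by (simp add: std_normal_density_def)
  qed
  have d: "0 < d" unfolding d_def by (rule step_1_pos)
  have "sqrt \<tau> \<le> d"
    unfolding d_def step_size_def
    using \<open>normal_pdf 1 \<le> 1\<close> \<tau> normal_density_pos[of 1 0 1]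
    by (intro real_sqrt_le_mono) (simp add: pos_le_divide_eq mult_left_le)
  then have inv_d: "1 / d \<le> sqrt (1 / \<tau>)"
    using \<tau> by (simp add: real_sqrt_divide frac_le)
  then have "1 / d \<le> Q" using \<open>sqrt (1 / \<tau>) \<le> Q\<close> by linarith
  have "T / d = T * (1 / d)" by simp
  also have "\<dots> \<le> T * sqrt (1 / \<tau>)"
    using inv_d sqrt_ln by (intro mult_left_mono) (auto simp: T_def)
  also have "\<dots> = 4 * Q" by (simp add: T_def Q)
  finally have Td: "T / d \<le> 4 * Q" .
  have "1 \<le> T" using sqrt_ln unfolding T_def by linarith

  have short: "real (card (march (- 1) 0 r)) \<le> Q + 1" if "\<And>u. u \<noteq> 0 \<Longrightarrow> d \<le> r u" for r
  proof -
    have "real (card (march (- 1) 0 r)) \<le> (0 - (- 1)) / d + 1"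
      by (rule march_finite_card_linear(2)) (use d that in auto)
    with \<open>1 / d \<le> Q\<close> show ?thesis by simp
  qed
  have long: "real (card (march 1 b r)) \<le> 4 * Q + 2 + 2 * (K * Q)"
    if b: "1 < b" "b \<le> max \<bar>zL\<bar> zR" and r: "\<And>u. u \<noteq> 0 \<Longrightarrow> step_size \<tau> u \<le> r u" for b r
  proof -
    have "real (card (march 1 b r)) \<le> T / d + 2 + log 2 b"
    proof (rule march_card_doubling)
      show "d \<le> r u" if "1 \<le> u" for u
        using that step_1_le(1)[of u] r[of u] by (simp add: d_def)
      show "u \<le> r u" if "T \<le> u" for u
        using that \<open>1 \<le> T\<close> r[of u] step_size_ge_self[OF \<tau> \<open>\<tau> \<le> 1\<close>, of u] by (simp add: T_def)
    qed (use b d \<open>1 \<le> T\<close> in auto)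
    \<comment> \<open>Changing the base costs the factor \<open>1 / ln 2\<close>, which is at most
      2.\<close>
    moreover have "log 2 b \<le> 2 * ln b"
    proof -
      have "1 / 2 \<le> ln (2 :: real)" using ln2_ge_two_thirds by simp
      then have "ln b * 1 \<le> ln b * (2 * ln 2)" using b by (intro mult_left_mono) auto
      then show ?thesis by (simp add: log_def pos_divide_le_eq algebra_simps)
    qed
    moreover have "ln b \<le> ln (max \<bar>zL\<bar> zR)" using b by simp
    ultimately show ?thesis using Td K by linarith
  qed
  let ?s = "step_size \<tau>" and ?s2 = "\<lambda>u. 2 * step_size \<tau> u"
  have "card (breakpoints zL zR \<tau>) \<le>
      card (march (- 1) 0 ?s2) + card (uminus ` march 1 (- zL) ?s2) + card {zL} +
      (card (uminus ` march (- 1) 0 ?s) + card {0 :: real} + card (march 1 zR ?s) + card {zR})"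
    unfolding breakpoints_eq_march
    by (intro order_trans[OF card_Un_le] add_mono order_refl)
  also have "\<dots> = card (march (- 1) 0 ?s2) + card (march 1 (- zL) ?s2) +
      card (march (- 1) 0 ?s) + card (march 1 zR ?s) + 3"
    by (simp add: card_image)
  finally have "real (card (breakpoints zL zR \<tau>)) \<le> real (card (march (- 1) 0 ?s2)) +
      real (card (march 1 (- zL) ?s2)) + real (card (march (- 1) 0 ?s)) + real (card (march 1 zR ?s)) + 3"
    by linarith
  also have "\<dots> \<le> (Q + 1) + (4 * Q + 2 + 2 * (K * Q)) + (Q + 1) + (4 * Q + 2 + 2 * (K * Q)) + 3"
  proof (intro add_mono order_refl short long)
    show "d \<le> ?s u" "d \<le> ?s2 u" if "u \<noteq> 0" for u using step_1_le[OF that] by (simp_all add: d_def)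
    show "?s u \<le> ?s2 u" if "u \<noteq> 0" for u using step_size_pos[OF \<tau> that] by simp
  qed (use zL zR in auto)
  \<comment> \<open>The two inner and two outer loops contribute 1 + 1 + 4 + 4 multiples of
    \<open>Q\<close>; the constant 9 contains the three points \<open>zL\<close>, 0 and
    \<open>zR\<close> and is absorbed using \<open>1 \<le> Q\<close>.\<close>
  also have "\<dots> = (10 + 4 * K) * Q + 9" by (simp add: algebra_simps)
  also have "\<dots> \<le> (19 + 4 * K) * Q" using \<open>1 \<le> Q\<close> by (simp add: algebra_simps)
  finally show ?thesis .
qed

end

text \<open>An absolute \<open>\<epsilon>\<close> makes the smallness of \<tau> precise. The count
  carries a term logarithmic in the prescribed end points, which the premise with \<open>K\<close>
  keeps within the claimed order; \<open>C\<close> depends on \<open>K\<close> alone.\<close>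

theorem theorem1:
  shows "\<exists>\<epsilon>>0. \<forall>K::real. \<exists>C::real. \<forall>\<tau> zL zR :: real.
    zL < 0 \<longrightarrow> 0 < zR \<longrightarrow>
    max (1 - normal_cdf zR) (normal_cdf zL) \<le> \<tau> \<longrightarrow>
    0 < \<tau> \<longrightarrow> \<tau> \<le> \<epsilon> \<longrightarrow> \<tau> \<le> \<epsilon> * min \<bar>zL\<bar> zR \<longrightarrow>
    (let A = breakpoints zL zR \<tau>; L = num_left A; R = num_right A; z = breakpoint_array A in
       finite A \<and>
       valid_breakpoints zL zR L R z \<and>
       (\<forall>x. 0 \<le> outer_approx L R z x - normal_cdf x \<and>
            outer_approx L R z x - normal_cdf x \<le> \<tau>) \<and>
       (ln (max \<bar>zL\<bar> zR) \<le> K * sqrt (1 / \<tau> * ln (1 / \<tau>)) \<longrightarrow>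
          real (card A) \<le> C * sqrt (1 / \<tau> * ln (1 / \<tau>))))"
proof -
  \<comment> \<open>The bound \<open>exp (- 1)\<close> serves the count. The halved tails make
    \<open>\<epsilon>\<close> strictly smaller than the tails at -1 and 1, so the tail conditions
    force \<open>zL < - 1\<close> and \<open>1 < zR\<close>: the starting points lie inside the
    range.\<close>
  define \<epsilon> where "\<epsilon> = Min {exp (- 1), normal_cdf (- 1) / 2, (1 - normal_cdf 1) / 2}"
  have \<epsilon>: "0 < \<epsilon>" "\<epsilon> \<le> exp (- 1)" "\<epsilon> < normal_cdf (- 1)" "\<epsilon> < 1 - normal_cdf 1"
    using normal_cdf_pos[of "- 1"] normal_cdf_less_1[of 1] by (auto simp: \<epsilon>_def min_less_iff_disj)
  show ?thesis
  proof (rule exI[of _ \<epsilon>], rule conjI[OF \<epsilon>(1)], rule allI)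
    fix K
    show "\<exists>C::real. \<forall>\<tau> zL zR :: real.
      zL < 0 \<longrightarrow> 0 < zR \<longrightarrow>
      max (1 - normal_cdf zR) (normal_cdf zL) \<le> \<tau> \<longrightarrow>
      0 < \<tau> \<longrightarrow> \<tau> \<le> \<epsilon> \<longrightarrow> \<tau> \<le> \<epsilon> * min \<bar>zL\<bar> zR \<longrightarrow>
      (let A = breakpoints zL zR \<tau>; L = num_left A; R = num_right A; z = breakpoint_array A in
         finite A \<and>
         valid_breakpoints zL zR L R z \<and>
         (\<forall>x. 0 \<le> outer_approx L R z x - normal_cdf x \<and>
              outer_approx L R z x - normal_cdf x \<le> \<tau>) \<and>
         (ln (max \<bar>zL\<bar> zR) \<le> K * sqrt (1 / \<tau> * ln (1 / \<tau>)) \<longrightarrow>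
            real (card A) \<le> C * sqrt (1 / \<tau> * ln (1 / \<tau>))))"
      unfolding Let_def
    proof (rule exI[of _ "19 + 4 * K"], intro allI impI conjI)
      fix \<tau> zL zR :: real
      assume z: "zL < 0" "0 < zR" and tail: "max (1 - normal_cdf zR) (normal_cdf zL) \<le> \<tau>"
        and \<tau>: "0 < \<tau>" "\<tau> \<le> \<epsilon>"
      have zL: "zL < - 1" and zR: "1 < zR"
        using tail \<tau> \<epsilon> normal_cdf_mono[of "- 1" zL] normal_cdf_mono[of zR 1] by force+
      let ?A = "breakpoints zL zR \<tau>"
      show fin: "finite ?A" by (rule finite_breakpoints[OF \<tau>(1) zL zR])
      have "0 \<in> ?A" "zL \<in> ?A" "zR \<in> ?A"
        by (auto simp: breakpoints_def secant_points_def tangent_points_def)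
      note array = fin this z breakpoints_subset[OF \<tau>(1) zL zR]
      show valid: "valid_breakpoints zL zR (num_left ?A) (num_right ?A) (breakpoint_array ?A)"
        by (rule valid_breakpoints_array[OF array])
      have tails: "1 - normal_cdf zR \<le> \<tau>" "normal_cdf zL \<le> \<tau>" using tail by simp_all
      fix x
      note bounds = outer_approx_bounds[OF valid breakpoint_array_image[OF array, symmetric] tails
          breakpoints_tangent[OF \<tau>(1) zL zR] breakpoints_secant[OF \<tau>(1) zL zR], of x]
      show "0 \<le> outer_approx (num_left ?A) (num_right ?A) (breakpoint_array ?A) x - normal_cdf x"
        using bounds by blast
      show "outer_approx (num_left ?A) (num_right ?A) (breakpoint_array ?A) x - normal_cdf x \<le> \<tau>"
        using bounds by blast
    next
      fix \<tau> zL zR :: real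
      assume "max (1 - normal_cdf zR) (normal_cdf zL) \<le> \<tau>" and \<tau>: "0 < \<tau>" "\<tau> \<le> \<epsilon>"
      then have "zL < - 1" "1 < zR"
        using \<epsilon> normal_cdf_mono[of "- 1" zL] normal_cdf_mono[of zR 1] by force+
      moreover assume "ln (max \<bar>zL\<bar> zR) \<le> K * sqrt (1 / \<tau> * ln (1 / \<tau>))"
      ultimately show "real (card (breakpoints zL zR \<tau>)) \<le> (19 + 4 * K) * sqrt (1 / \<tau> * ln (1 / \<tau>))"
        using \<tau> \<epsilon>(2) by (intro card_breakpoints_le) auto
    qed
  qed
qed

end
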